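(* Let $r,s,t,m$ be positive integers. Let $G$ be an $n$-vertex graph with no copy of $K_r$ as a subgraph and no copy of $K_{s,t}$ as an induced subgraph. If $t_m(G)$ is the number of cliques of order $m$ in $G$, then \[ m\cdot t_m(G) \leq 2(t+r)^{tm/s}(r+s)^s n^{m-\frac{m-1}{s}} + (r+s)^s n^{m-1}. \]
   Context: A clique of order $m$ is a set of $m$ pairwise adjacent vertices. $K_{s,t}$ is the complete bipartite graph with parts of sizes $s$ and $t$. *)

theory Defs
  imports Complex_Main "Graph_Theory.Graph_Theory"
begin

text \<open>
  An undirected simple graph is a finite symmetric digraph without loops and parallel arcs
  (locale \<^locale>\<open>graph\<close>): each undirected edge is a pair of opposite arcs, and adjacency of
  \<open>u\<close> and \<open>v\<close> is \<^const>\<open>dominates\<close>.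
  The predicates \<open>K\<^bsub>r\<^esub>\<close> and \<open>K\<^bsub>s,t\<^esub>\<close> hold for all graphs isomorphic to the
  (bipartite) complete graph, so a copy of such a graph in \<open>G\<close> is a (possibly induced)
  subgraph of \<open>G\<close> satisfying the predicate.
\<close>

definition is_clique :: "('a, 'b) pre_digraph \<Rightarrow> nat \<Rightarrow> 'a set \<Rightarrow> bool" where
  "is_clique G m S \<longleftrightarrow> S \<subseteq> verts G \<and> finite S \<and> card S = m
     \<and> (\<forall>u\<in>S. \<forall>v\<in>S. u \<noteq> v \<longrightarrow> u \<rightarrow>\<^bsub>G\<^esub> v)"

definition clique_count :: "nat \<Rightarrow> ('a, 'b) pre_digraph \<Rightarrow> nat" where
  "clique_count m G = card {S. is_clique G m S}"

end

theory Submission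
  imports Defs "HOL-Library.Ramsey"
begin

text \<open>
  Count pairs \<open>(K, S)\<close> of an \<open>(m - 1)\<close>-clique \<open>K\<close> and an independent \<open>s\<close>-set \<open>S\<close> that are
  completely joined. Put \<open>R = (r + s) ^ s\<close> and \<open>Q = (t + r) ^ t\<close>. By Ramsey's theorem the
  common neighbourhood of \<open>S\<close> has fewer than \<open>Q\<close> vertices, since it would otherwise contain an
  independent \<open>t\<close>-set. So there are at most \<open>n ^ s * Q ^ (m - 1)\<close> pairs. If \<open>K\<close> has
  \<open>d \<ge> R\<close> common neighbours, Ramsey's theorem and averaging over the \<open>R\<close>-subsets give at least
  \<open>(d / R) ^ s\<close> pairs. Finally \<open>m * t\<^sub>m\<close> is at most the sum of the \<open>d\<close>'s, and
  \<open>d \<le> L + d ^ s / L ^ (s - 1)\<close> for every \<open>L > 0\<close>; the choice of \<open>L\<close> that balances the two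
  terms yields the bound.
\<close>

section \<open>Binomial coefficients and Ramsey's theorem\<close>

lemma binomial_le_power: "n choose k \<le> n ^ k"
  by (cases "k \<le> n") (auto intro: binomial_le_pow simp: binomial_eq_0)

text \<open>The Erdos-Szekeres bound for two colours, available for colourings of the 2-subsets of
  an initial segment of the naturals, is transported to \<open>V\<close> along an enumeration
  \<open>g\<close>. Related pairs get colour 0, unrelated pairs colour 1.\<close>

lemma ramsey_binary_relation:
  assumes "finite V" "sym E" "(p + q) choose p \<le> card V"
  obtains S where "S \<subseteq> V" "card S = p" "\<And>u v. u \<in> S \<Longrightarrow> v \<in> S \<Longrightarrow> u \<noteq> v \<Longrightarrow> (u, v) \<in> E"
  | S where "S \<subseteq> V" "card S = q" "\<And>u v. u \<in> S \<Longrightarrow> v \<in> S \<Longrightarrow> u \<noteq> v \<Longrightarrow> (u, v) \<notin> E"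
proof -
  define N where "N = (p + q) choose p"
  obtain g where g: "bij_betw g {..<card V} V"
    using ex_bij_betw_nat_finite[OF assms(1)] atLeast0LessThan by metis
  have inj: "inj_on g {..<N}" and img: "g ` {..<N} \<subseteq> V"
    using g assms(3) unfolding N_def bij_betw_def by (force intro: inj_on_subset)+
  define f where "f e = (if \<exists>i j. e = {i, j} \<and> (g i, g j) \<in> E then 0 else 1::nat)" for e
  have "partn_lst {..<N} [p, q] 2"
    using ramsey2_full[of 2 p q] unfolding N_def ES2_choose .
  moreover have "f \<in> nsets {..<N} 2 \<rightarrow> {..<2}"
    by (auto simp: f_def)
  ultimately obtain i H where i: "i < 2" and H: "H \<in> nsets {..<N} ([p, q] ! i)"
    and mono: "f ` nsets H 2 \<subseteq> {i}"
    unfolding partn_lst_def monochromatic_def by (auto simp: eval_nat_numeral)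
  have HN: "H \<subseteq> {..<N}" and cH: "card H = [p, q] ! i"
    using H by (auto simp: nsets_def)
  have gH: "g ` H \<subseteq> V" "card (g ` H) = [p, q] ! i"
    using HN img cH inj by (auto simp: card_image inj_on_subset)
  have col: "(g a, g b) \<in> E \<longleftrightarrow> i = 0" if "a \<in> H" "b \<in> H" "g a \<noteq> g b" for a b
  proof -
    have "a \<noteq> b"
      using that by blast
    then have "{a, b} \<in> nsets H 2"
      using that by simp
    then have "f {a, b} = i"
      using mono by blast
    \<comment> \<open>Symmetry of \<open>E\<close> makes the colour of an unordered pair independent
      of how its elements are ordered.\<close>
    moreover have "(\<exists>i j. {a, b} = {i, j} \<and> (g i, g j) \<in> E) \<longleftrightarrow> (g a, g b) \<in> E"
      using assms(2) by (auto simp: doubleton_eq_iff dest: symD)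
    ultimately show ?thesis
      by (auto simp: f_def split: if_splits)
  qed
  show thesis
  proof (cases "i = 0")
    case True
    then show thesis
      using gH col by (intro that(1)[of "g ` H"]) auto
  next
    case False
    then have "i = 1"
      using i by simp
    then show thesis
      using gH col by (intro that(2)[of "g ` H"]) auto
  qed
qed

section \<open>Averaging over subsets of fixed size\<close>

text \<open>Multiplied by \<open>fact s\<close>, both sides become products of \<open>s\<close>
  factors, and \<open>d * (R - i) \<le> R * (d - i)\<close> for each \<open>i\<close> because
  \<open>R \<le> d\<close>.\<close>

lemma pow_mult_binomial_le:
  assumes "s \<le> R" "R \<le> d"
  shows "d ^ s * (R choose s) \<le> R ^ s * (d choose s)"
proof -
  have falling: "fact s * (x choose s) = (\<Prod>i<s. x - i)" for x :: nat
  proof (induction s)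
    case (Suc s)
    have "Suc s * (x choose Suc s) = (x - s) * (x choose s)"
      by (simp only: binomial_absorption binomial_absorb_comp)
    then have "fact (Suc s) * (x choose Suc s) = fact s * (x choose s) * (x - s)"
      by (metis fact_Suc mult.assoc mult.commute of_nat_id)
    then show ?case
      using Suc by simp
  qed simp
  have "(\<Prod>i<s. d * (R - i)) \<le> (\<Prod>i<s. R * (d - i))"
    using assms by (intro prod_mono) (auto simp: diff_mult_distrib2 mult.commute intro!: diff_le_mono2 mult_le_mono1)
  then have "fact s * (d ^ s * (R choose s)) \<le> fact s * (R ^ s * (d choose s))"
    by (simp add: prod.distrib mult.left_commute flip: falling)
  then show ?thesis
    by simp
qed

text \<open>Count the pairs of a set \<open>S\<close> in \<open>F\<close> and an
  \<open>R\<close>-subset \<open>X\<close> of \<open>N\<close> containing it. Each \<open>X\<close>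
  occurs at least once and each \<open>S\<close> at most \<open>(card N - s) choose (R - s)\<close>
  times, so \<open>card F\<close> is at least the ratio of \<open>card N choose s\<close> to
  \<open>R choose s\<close>.\<close>

lemma card_hitting_family:
  assumes N: "finite N" and sR: "s \<le> R" and RN: "R \<le> card N"
    and F: "\<And>S. S \<in> F \<Longrightarrow> S \<subseteq> N \<and> card S = s"
    and hit: "\<And>X. X \<subseteq> N \<Longrightarrow> card X = R \<Longrightarrow> \<exists>S\<in>F. S \<subseteq> X"
  shows "card N ^ s \<le> R ^ s * card F"
proof -
  let ?d = "card N"
  have finF: "finite F"
    using N F by (intro finite_subset[of F "Pow N"]) auto
  have ext: "card {X. S \<subseteq> X \<and> X \<subseteq> N \<and> card X = R} \<le> (?d - s) choose (R - s)" if "S \<in> F" for S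
  proof -
    have S: "S \<subseteq> N" "card S = s" "finite S"
      using F[OF that] N finite_subset by auto
    have "{X. S \<subseteq> X \<and> X \<subseteq> N \<and> card X = R} \<subseteq> (\<lambda>Y. S \<union> Y) ` {Y. Y \<subseteq> N - S \<and> card Y = R - s}"
    proof
      fix X assume "X \<in> {X. S \<subseteq> X \<and> X \<subseteq> N \<and> card X = R}"
      then show "X \<in> (\<lambda>Y. S \<union> Y) ` {Y. Y \<subseteq> N - S \<and> card Y = R - s}"
        using S by (intro image_eqI[of _ _ "X - S"]) (auto simp: card_Diff_subset)
    qed
    then have "card {X. S \<subseteq> X \<and> X \<subseteq> N \<and> card X = R} \<le> card {Y. Y \<subseteq> N - S \<and> card Y = R - s}"
      using N by (intro surj_card_le) auto
    also have "\<dots> = (?d - s) choose (R - s)"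
      using N S by (simp add: n_subsets card_Diff_subset)
    finally show ?thesis .
  qed
  have "?d choose R = card {X. X \<subseteq> N \<and> card X = R}"
    using N by (simp add: n_subsets)
  also have "\<dots> \<le> card (\<Union>S\<in>F. {X. S \<subseteq> X \<and> X \<subseteq> N \<and> card X = R})"
    using N finF hit by (intro card_mono) auto
  also have "\<dots> \<le> (\<Sum>S\<in>F. card {X. S \<subseteq> X \<and> X \<subseteq> N \<and> card X = R})"
    using finF by (rule card_UN_le)
  also have "\<dots> \<le> card F * ((?d - s) choose (R - s))"
    using ext sum_bounded_above[of F _ "(?d - s) choose (R - s)"] by simp
  finally have "(?d choose R) * (R choose s) \<le> card F * ((?d - s) choose (R - s)) * (R choose s)"
    by (rule mult_le_mono1)
  \<comment> \<open>Both products count chains of an \<open>s\<close>-set inside an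
    \<open>R\<close>-set inside \<open>N\<close>; the rewriting exposes a common positive factor to
    cancel.\<close>
  then have "(?d choose s) * ((?d - s) choose (R - s))
      \<le> card F * (R choose s) * ((?d - s) choose (R - s))"
    unfolding choose_mult[OF sR RN] by (simp only: mult_ac)
  moreover have "(?d - s) choose (R - s) > 0"
    using RN by simp
  ultimately have "?d choose s \<le> card F * (R choose s)"
    by (metis mult_le_cancel2)
  then have "?d ^ s * (R choose s) \<le> R ^ s * card F * (R choose s)"
    using pow_mult_binomial_le[OF sR RN] by (metis (no_types, lifting) le_trans mult.assoc mult_le_mono2)
  then show ?thesis
    using sR by simp
qed

text \<open>If \<open>d > L\<close>, then \<open>d = d ^ s / d ^ (s - 1)\<close>, and replacing the
  denominator by \<open>L ^ (s - 1)\<close> only increases the quotient.\<close>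

lemma le_add_pow_div:
  fixes d L :: real
  assumes "d \<ge> 0" "L > 0" "s > 0"
  shows "d \<le> L + d ^ s / L ^ (s - 1)"
proof (cases "d \<le> L")
  case False
  have "d * L ^ (s - 1) \<le> d * d ^ (s - 1)"
    using assms False by (intro mult_left_mono power_mono) auto
  also have "\<dots> = d ^ s"
    using power_minus_mult[OF assms(3), of d] by (simp add: mult.commute)
  finally show ?thesis
    using assms by (simp add: pos_le_divide_eq add_increasing)
qed (use assms in \<open>simp add: add_increasing2\<close>)

section \<open>Cliques, independent sets and common neighbourhoods\<close>

text \<open>For empty \<open>A\<close> this is the whole vertex set, so cliques of order 1 need no
  separate treatment.\<close>

definition common_nbrs :: "('a, 'b) pre_digraph \<Rightarrow> 'a set \<Rightarrow> 'a set" where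
  "common_nbrs G A = {v \<in> verts G. \<forall>u\<in>A. u \<rightarrow>\<^bsub>G\<^esub> v}"

text \<open>The condition includes \<open>u = v\<close>, which is harmless since graphs have no
  loops.\<close>

definition indep_sets :: "('a, 'b) pre_digraph \<Rightarrow> nat \<Rightarrow> 'a set \<Rightarrow> 'a set set" where
  "indep_sets G k A = {S. S \<subseteq> A \<and> card S = k \<and> (\<forall>u\<in>S. \<forall>v\<in>S. \<not> u \<rightarrow>\<^bsub>G\<^esub> v)}"

context graph
begin

lemma adj_sym: "u \<rightarrow>\<^bsub>G\<^esub> v \<longleftrightarrow> v \<rightarrow>\<^bsub>G\<^esub> u"
  using arcs_ends_symmetric[OF sym_arcs] by blast

lemma arcs_ends_induce: "arcs_ends (G \<restriction> A) = {(u, v). u \<in> A \<and> v \<in> A \<and> u \<rightarrow>\<^bsub>G\<^esub> v}"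
  by (auto simp: arcs_ends_conv)

lemma graph_induce:
  assumes "A \<subseteq> verts G"
  shows "graph (G \<restriction> A)"
proof -
  have "finite A"
    using assms finite_verts by (rule finite_subset)
  moreover have "symmetric (G \<restriction> A)"
    using induced_graph_imp_symmetric[OF sym_arcs induced_induce[OF assms]] .
  ultimately show ?thesis
    by unfold_locales (auto simp: no_loops intro: no_multi_arcs)
qed

lemma finite_common_nbrs [simp]: "finite (common_nbrs G A)"
  by (simp add: common_nbrs_def)

lemma finite_cliques [simp]: "finite {K. is_clique G k K}"
  by (rule finite_subset[of _ "Pow (verts G)"]) (auto simp: is_clique_def)

lemma finite_indep_sets [simp]: "finite A \<Longrightarrow> finite (indep_sets G k A)"
  by (rule finite_subset[of _ "Pow A"]) (auto simp: indep_sets_def)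

lemma clique_imp_complete_subgraph:
  assumes "is_clique G r K"
  shows "\<exists>H. subgraph H G \<and> K\<^bsub>r\<^esub> H"
proof (intro exI conjI)
  have K: "K \<subseteq> verts G"
    using assms by (simp add: is_clique_def)
  show "subgraph (G \<restriction> K) G"
    using induced_induce[OF K] by (rule induced_imp_subgraph)
  show "K\<^bsub>r\<^esub> (G \<restriction> K)"
    using assms graph_induce[OF K]
    by (auto simp: complete_digraph_def arcs_ends_induce is_clique_def dest: adj_not_same)
qed

lemma indep_pair_imp_induced_bipartite:
  assumes S: "S \<in> indep_sets G s (verts G)" and T: "T \<in> indep_sets G t (common_nbrs G S)"
  shows "\<exists>H. induced_subgraph H G \<and> K\<^bsub>s,t\<^esub> H"
proof (intro exI conjI)
  have st: "\<And>u v. u \<in> S \<Longrightarrow> v \<in> T \<Longrightarrow> u \<rightarrow>\<^bsub>G\<^esub> v"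
    and sub: "S \<union> T \<subseteq> verts G"
    using S T by (auto simp: indep_sets_def common_nbrs_def)
  show "induced_subgraph (G \<restriction> (S \<union> T)) G"
    using induced_induce[OF sub] .
  have "arcs_ends (G \<restriction> (S \<union> T)) = S \<times> T \<union> T \<times> S"
    using S T st adj_sym by (auto simp: arcs_ends_induce indep_sets_def)
  \<comment> \<open>A vertex in both parts would be adjacent to itself.\<close>
  moreover have "S \<inter> T = {}"
    using st adj_not_same by blast
  ultimately show "K\<^bsub>s,t\<^esub> (G \<restriction> (S \<union> T))"
    using graph_induce[OF sub] S T
    by (auto simp: complete_bipartite_digraph_def indep_sets_def)
qed

text \<open>Ramsey's theorem for adjacency on \<open>A\<close>; a clique of order \<open>r\<close>
  is excluded. Passing from lower index \<open>r\<close> to \<open>s\<close> in the binomial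
  coefficient gives a bound whose exponent is \<open>s\<close>.\<close>

lemma ex_indep_set:
  assumes "\<not> (\<exists>H. subgraph H G \<and> K\<^bsub>r\<^esub> H)" "A \<subseteq> verts G" "(r + s) ^ s \<le> card A"
  shows "\<exists>S\<in>indep_sets G s A. S \<subseteq> A"
proof -
  have fin: "finite A"
    using assms(2) finite_verts by (rule finite_subset)
  have "(r + s) choose r = (r + s) choose s"
    using binomial_symmetric[of s "r + s"] by simp
  then have "(r + s) choose r \<le> card A"
    using assms(3) binomial_le_power[of "r + s" s] by simp
  then show ?thesis
  proof (rule ramsey_binary_relation[OF fin sym_arcs[unfolded symmetric_def]])
    fix S assume "S \<subseteq> A" "card S = r" "\<And>u v. u \<in> S \<Longrightarrow> v \<in> S \<Longrightarrow> u \<noteq> v \<Longrightarrow> u \<rightarrow>\<^bsub>G\<^esub> v"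
    then have "is_clique G r S"
      using assms(2) fin finite_subset by (auto simp: is_clique_def)
    then show ?thesis
      using assms(1) clique_imp_complete_subgraph by blast
  next
    fix S assume "S \<subseteq> A" "card S = s" "\<And>u v. u \<in> S \<Longrightarrow> v \<in> S \<Longrightarrow> u \<noteq> v \<Longrightarrow> \<not> u \<rightarrow>\<^bsub>G\<^esub> v"
    then have "S \<in> indep_sets G s A"
      using adj_not_same by (fastforce simp: indep_sets_def)
    then show ?thesis
      by (auto simp: indep_sets_def)
  qed
qed

text \<open>Every subset of \<open>A\<close> with \<open>(r + s) ^ s\<close> elements contains an
  independent \<open>s\<close>-set, so these sets form a hitting family.\<close>

lemma card_indep_sets_ge:
  assumes "\<not> (\<exists>H. subgraph H G \<and> K\<^bsub>r\<^esub> H)" "A \<subseteq> verts G" "(r + s) ^ s \<le> card A" "s > 0"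
  shows "card A ^ s \<le> ((r + s) ^ s) ^ s * card (indep_sets G s A)"
proof (rule card_hitting_family)
  show "finite A"
    using assms(2) finite_verts by (rule finite_subset)
  show "s \<le> (r + s) ^ s"
    using assms(4) self_le_power[of "r + s" s] by simp
  show "\<exists>S\<in>indep_sets G s A. S \<subseteq> X" if X: "X \<subseteq> A" "card X = (r + s) ^ s" for X
  proof -
    obtain S where "S \<in> indep_sets G s X" "S \<subseteq> X"
      using ex_indep_set[OF assms(1), of X s] X assms(2) by auto
    then show ?thesis
      using X by (auto simp: indep_sets_def)
  qed
qed (use assms in \<open>auto simp: indep_sets_def\<close>)

text \<open>A larger common neighbourhood would contain an independent \<open>t\<close>-set by
  Ramsey's theorem, which together with \<open>S\<close> induces a forbidden bipartite
  graph.\<close>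

lemma card_common_nbrs_indep_less:
  assumes "\<not> (\<exists>H. subgraph H G \<and> K\<^bsub>r\<^esub> H)" "\<not> (\<exists>H. induced_subgraph H G \<and> K\<^bsub>s,t\<^esub> H)"
    and "S \<in> indep_sets G s (verts G)"
  shows "card (common_nbrs G S) < (r + t) ^ t"
proof (rule ccontr)
  assume "\<not> ?thesis"
  then obtain T where "T \<in> indep_sets G t (common_nbrs G S)"
    using ex_indep_set[OF assms(1), of "common_nbrs G S" t] by (auto simp: common_nbrs_def)
  then show False
    using indep_pair_imp_induced_bipartite[OF assms(3)] assms(2) by blast
qed

section \<open>Double counting with cliques\<close>

lemma card_cliques_subset_le:
  assumes "finite A"
  shows "card {K. is_clique G k K \<and> K \<subseteq> A} \<le> card A ^ k"
proof -
  have "card {K. is_clique G k K \<and> K \<subseteq> A} \<le> card {K. K \<subseteq> A \<and> card K = k}"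
    using assms by (intro card_mono) (auto simp: is_clique_def)
  also have "\<dots> \<le> card A ^ k"
    using assms by (simp add: n_subsets binomial_le_power)
  finally show ?thesis .
qed

lemma clique_count_le: "clique_count k G \<le> card (verts G) ^ k"
proof -
  have "{K. is_clique G k K \<and> K \<subseteq> verts G} = {K. is_clique G k K}"
    by (auto simp: is_clique_def)
  then show ?thesis
    using card_cliques_subset_le[of "verts G" k] by (simp add: clique_count_def)
qed

text \<open>A clique \<open>T\<close> with a marked vertex \<open>v\<close> is sent to
  \<open>(T - {v}, v)\<close>. This is injective, and \<open>v\<close> is a common neighbour of
  \<open>T - {v}\<close>.\<close>

lemma Suc_mult_clique_count_le:
  "Suc k * clique_count (Suc k) G \<le> (\<Sum>K | is_clique G k K. card (common_nbrs G K))"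
proof -
  let ?P = "SIGMA T:{T. is_clique G (Suc k) T}. T"
  let ?Q = "SIGMA K:{K. is_clique G k K}. common_nbrs G K"
  have "inj_on (\<lambda>(T, v). (T - {v}, v)) ?P"
    by (auto simp: inj_on_def)
  moreover have "(\<lambda>(T, v). (T - {v}, v)) ` ?P \<subseteq> ?Q"
    by (auto simp: is_clique_def common_nbrs_def)
  moreover have "finite ?Q"
    by (intro finite_SigmaI) auto
  ultimately have "card ?P \<le> card ?Q"
    by (rule card_inj_on_le)
  moreover have "card ?P = Suc k * clique_count (Suc k) G"
  proof -
    have "card ?P = (\<Sum>T | is_clique G (Suc k) T. card T)"
      by (intro card_SigmaI) (auto simp: is_clique_def)
    also have "\<dots> = (\<Sum>T | is_clique G (Suc k) T. Suc k)"
      by (intro sum.cong) (auto simp: is_clique_def)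
    finally show ?thesis
      by (simp add: clique_count_def)
  qed
  moreover have "card ?Q = (\<Sum>K | is_clique G k K. card (common_nbrs G K))"
    by (intro card_SigmaI) auto
  ultimately show ?thesis
    by simp
qed

text \<open>Exchange the order of summation: the \<open>k\<close>-cliques joined to a fixed
  \<open>S\<close> lie in the common neighbourhood of \<open>S\<close>, which has fewer than
  \<open>(r + t) ^ t\<close> vertices.\<close>

lemma sum_card_indep_sets_common_nbrs_le:
  assumes Kr: "\<not> (\<exists>H. subgraph H G \<and> K\<^bsub>r\<^esub> H)"
    and Kst: "\<not> (\<exists>H. induced_subgraph H G \<and> K\<^bsub>s,t\<^esub> H)"
  shows "(\<Sum>K | is_clique G k K. card (indep_sets G s (common_nbrs G K)))
    \<le> card (verts G) ^ s * ((r + t) ^ t) ^ k"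
proof -
  let ?C = "{K. is_clique G k K}" and ?I = "indep_sets G s (verts G)"
  have "(\<Sum>K\<in>?C. card (indep_sets G s (common_nbrs G K))) =
      (\<Sum>K\<in>?C. card {S \<in> ?I. \<forall>u\<in>K. \<forall>v\<in>S. u \<rightarrow>\<^bsub>G\<^esub> v})"
    by (intro sum.cong refl arg_cong[where f = card]) (auto simp: indep_sets_def common_nbrs_def)
  also have "\<dots> = (\<Sum>S\<in>?I. card {K \<in> ?C. \<forall>u\<in>K. \<forall>v\<in>S. u \<rightarrow>\<^bsub>G\<^esub> v})"
    by (intro sum_multicount_gen) auto
  also have "\<dots> \<le> card ?I * ((r + t) ^ t) ^ k"
  proof -
    have "card {K \<in> ?C. \<forall>u\<in>K. \<forall>v\<in>S. u \<rightarrow>\<^bsub>G\<^esub> v} \<le> ((r + t) ^ t) ^ k" if S: "S \<in> ?I" for S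
    proof -
      have "card {K \<in> ?C. \<forall>u\<in>K. \<forall>v\<in>S. u \<rightarrow>\<^bsub>G\<^esub> v} \<le> card {K. is_clique G k K \<and> K \<subseteq> common_nbrs G S}"
        using adj_sym
        by (intro card_mono finite_subset[OF _ finite_cliques[of k]])
           (auto simp: is_clique_def common_nbrs_def)
      also have "\<dots> \<le> card (common_nbrs G S) ^ k"
        by (rule card_cliques_subset_le) simp
      also have "\<dots> \<le> ((r + t) ^ t) ^ k"
        using card_common_nbrs_indep_less[OF Kr Kst S] by (intro power_mono) auto
      finally show ?thesis .
    qed
    then show ?thesis
      using sum_bounded_above[of ?I _ "((r + t) ^ t) ^ k"] by simp
  qed
  also have "card ?I \<le> card {S. S \<subseteq> verts G \<and> card S = s}"
    by (intro card_mono) (auto simp: indep_sets_def)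
  then have "card ?I \<le> card (verts G) ^ s"
    using binomial_le_power[of "card (verts G)" s] by (simp add: n_subsets)
  then have "card ?I * ((r + t) ^ t) ^ k \<le> card (verts G) ^ s * ((r + t) ^ t) ^ k"
    by (rule mult_le_mono1)
  finally show ?thesis .
qed

text \<open>A bound on each common degree is summed over all \<open>k\<close>-cliques;
  \<open>L\<close> stays free so that the two resulting terms can be balanced afterwards.\<close>

lemma Suc_mult_clique_count_le_param:
  fixes L :: real
  assumes Kr: "\<not> (\<exists>H. subgraph H G \<and> K\<^bsub>r\<^esub> H)"
    and Kst: "\<not> (\<exists>H. induced_subgraph H G \<and> K\<^bsub>s,t\<^esub> H)"
    and s: "s > 0" and L: "L > 0"
  defines "n \<equiv> real (card (verts G))" and "R \<equiv> (real r + real s) ^ s" and "Q \<equiv> (real r + real t) ^ t"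
  shows "real (Suc k) * real (clique_count (Suc k) G)
    \<le> n ^ k * (R + L) + R ^ s * n ^ s * Q ^ k / L ^ (s - 1)"
proof -
  let ?C = "{K. is_clique G k K}"
  let ?d = "\<lambda>K. real (card (common_nbrs G K))"
    and ?i = "\<lambda>K. real (card (indep_sets G s (common_nbrs G K)))"
  have R0: "R \<ge> 0"
    by (simp add: R_def)
  have Rr: "R = real ((r + s) ^ s)" and Qr: "Q = real ((r + t) ^ t)"
    by (simp_all add: R_def Q_def)
  \<comment> \<open>Degrees below the Ramsey threshold are absorbed by the summand \<open>R\<close>;
    for the others, many independent \<open>s\<close>-sets bound \<open>?d K ^ s\<close>.\<close>
  have deg: "?d K \<le> R + L + R ^ s / L ^ (s - 1) * ?i K" for K
  proof (cases "(r + s) ^ s \<le> card (common_nbrs G K)")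
    case True
    then have "card (common_nbrs G K) ^ s
        \<le> ((r + s) ^ s) ^ s * card (indep_sets G s (common_nbrs G K))"
      using Kr s by (intro card_indep_sets_ge) (auto simp: common_nbrs_def)
    then have "?d K ^ s \<le> R ^ s * ?i K"
      unfolding Rr by (metis of_nat_le_iff of_nat_mult of_nat_power)
    then have "?d K ^ s / L ^ (s - 1) \<le> R ^ s * ?i K / L ^ (s - 1)"
      using L by (intro divide_right_mono) auto
    moreover have "?d K \<le> L + ?d K ^ s / L ^ (s - 1)"
      using L s by (intro le_add_pow_div) auto
    ultimately show ?thesis
      using R0 by simp
  next
    case False
    then have "?d K \<le> R"
      unfolding Rr by linarith
    moreover have "0 \<le> R ^ s / L ^ (s - 1) * ?i K"
      using R0 L by simp
    ultimately show ?thesis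
      using L by linarith
  qed
  have "real (Suc k) * real (clique_count (Suc k) G) \<le> (\<Sum>K\<in>?C. ?d K)"
    using Suc_mult_clique_count_le[of k] by (metis of_nat_le_iff of_nat_mult of_nat_sum)
  also have "\<dots> \<le> (\<Sum>K\<in>?C. R + L + R ^ s / L ^ (s - 1) * ?i K)"
    by (intro sum_mono deg)
  also have "\<dots> = real (clique_count k G) * (R + L) + R ^ s / L ^ (s - 1) * (\<Sum>K\<in>?C. ?i K)"
    by (simp add: sum.distrib sum_distrib_left clique_count_def)
  also have "\<dots> \<le> n ^ k * (R + L) + R ^ s / L ^ (s - 1) * (n ^ s * Q ^ k)"
  proof (intro add_mono mult_mono mult_left_mono)
    show "real (clique_count k G) \<le> n ^ k"
      using clique_count_le[of k] unfolding n_def by (metis of_nat_le_iff of_nat_power)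
    show "(\<Sum>K\<in>?C. ?i K) \<le> n ^ s * Q ^ k"
      using sum_card_indep_sets_common_nbrs_le[OF Kr Kst, of k] unfolding n_def Qr
      by (metis of_nat_le_iff of_nat_mult of_nat_power of_nat_sum)
  qed (use R0 L in \<open>auto simp: n_def intro!: sum_nonneg\<close>)
  finally show ?thesis
    by (simp add: mult_ac)
qed

end

theorem theorem2:
  fixes G :: "('a, 'b) pre_digraph" and n r s t m :: nat
  assumes "r > 0" and "s > 0" and "t > 0" and "m > 0"
    and "graph G" and "card (verts G) = n"
    and "\<not> (\<exists>H. subgraph H G \<and> K\<^bsub>r\<^esub> H)"
    and "\<not> (\<exists>H. induced_subgraph H G \<and> K\<^bsub>s,t\<^esub> H)"
  shows "real m * real (clique_count m G)
    \<le> 2 * (real t + real r) powr (real t * real m / real s) * (real r + real s) ^ s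
          * real n powr (real m - (real m - 1) / real s)
      + (real r + real s) ^ s * real n ^ (m - 1)"
proof -
  interpret graph G by fact
  obtain k where m: "m = Suc k"
    using assms(4) gr0_implies_Suc by blast
  define R where "R = (real r + real s) ^ s"
  define Q where "Q = (real r + real t) ^ t"
  have R: "R > 0" and Q: "Q > 0"
    using assms(1) by (simp_all add: R_def Q_def add_pos_nonneg)
  show ?thesis
  \<comment> \<open>The calculation with powers of \<open>n\<close>, whose exponents may be
    negative, needs \<open>n > 0\<close>.\<close>
  proof (cases "n = 0")
    case True
    then have "clique_count m G = 0"
      using clique_count_le[of m] assms(4,6) by (simp add: zero_power)
    then show ?thesis
      by simp
  next
    case False
    then have n: "real n > 0"
      by simp
    \<comment> \<open>This solves \<open>n ^ k * L = R ^ s * n ^ s * Q ^ k / L ^ (s - 1)\<close>,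
      making the two terms that depend on \<open>L\<close> equal; hence the factor 2.\<close>
    define L where "L = R * Q powr (k / s) * real n powr (1 - k / s)"
    have L: "L > 0"
      using R Q n by (simp add: L_def)
    have "L ^ s = R ^ s * Q ^ k * real n powr (real s - real k)"
      using assms(2) R Q n
      by (simp add: L_def power_mult_distrib powr_power powr_realpow right_diff_distrib)
    then have Ls: "R ^ s * real n ^ s * Q ^ k = real n ^ k * L ^ s"
      using n by (simp add: powr_diff powr_realpow)
    have "R ^ s * real n ^ s * Q ^ k / L ^ (s - 1) = real n ^ k * L"
      unfolding Ls power_minus_mult[OF assms(2), of L, symmetric] using L by simp
    then have "real m * real (clique_count m G) \<le> 2 * (real n ^ k * L) + R * real n ^ k"
      using Suc_mult_clique_count_le_param[OF assms(7,8,2) L, of k] assms(6)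
      by (simp add: m R_def Q_def algebra_simps)
    \<comment> \<open>With \<open>k = m - 1\<close>, the exponents of \<open>n\<close> add up:
      \<open>k + (1 - k / s) = m - (m - 1) / s\<close>.\<close>
    also have "real n ^ k * L = Q powr (k / s) * R * real n powr (real m - (real m - 1) / real s)"
      using n by (simp add: L_def m powr_add powr_diff powr_realpow)
    \<comment> \<open>The base \<open>t + r\<close> is at least 1, so the exponent may be raised
      from \<open>t * k / s\<close> to \<open>t * m / s\<close>.\<close>
    also have "Q powr (k / s) \<le> (real t + real r) powr (real t * real m / real s)"
    proof -
      have "Q powr (k / s) = (real t + real r) powr (real t * real k / real s)"
        using assms(1) by (simp add: Q_def powr_powr add.commute flip: powr_realpow)
      also have "\<dots> \<le> (real t + real r) powr (real t * real m / real s)"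
        using assms(1) by (intro powr_mono divide_right_mono mult_left_mono) (auto simp: m)
      finally show ?thesis .
    qed
    finally show ?thesis
      using R by (simp add: R_def m mult.assoc mult_right_mono)
  qed
qed

end
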